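(* Let $\lambda>0$, $\alpha>0$, let $\mu>0$ be the lowest eigenvalue of $\mathbf{J}$, and let $\delta_0,\nu_0>0$ satisfy $\delta_0\nu_0\max(1,\alpha)\|\mathbf{D}\|^2<1$. Let $\boldsymbol{v}^{[0]},\boldsymbol{h}^{[0]}\in\mathbb{R}^{|\Upsilon|}$ be given, $\boldsymbol{u}^{[0]}=\bar{\boldsymbol{u}}^{[0]}=\mathbf{D}\boldsymbol{v}^{[0]}$, $\boldsymbol{\ell}^{[0]}=\bar{\boldsymbol{\ell}}^{[0]}=\alpha\mathbf{D}\boldsymbol{h}^{[0]}$. For $t=0,1,2,\dots$ define $$\begin{pmatrix}\boldsymbol{v}^{[t+1]}\\ \boldsymbol{h}^{[t+1]}\end{pmatrix}=\mathrm{prox}_{\delta_t\Phi}\left(\begin{pmatrix}\boldsymbol{v}^{[t]}\\ \boldsymbol{h}^{[t]}\end{pmatrix}-\delta_t\begin{pmatrix}\mathbf{D}^*\bar{\boldsymbol{u}}^{[t]}\\ \alpha\mathbf{D}^*\bar{\boldsymbol{\ell}}^{[t]}\end{pmatrix}\right),$$ $$\begin{pmatrix}\boldsymbol{u}^{[t+1]}\\ \boldsymbol{\ell}^{[t+1]}\end{pmatrix}=\mathrm{prox}_{\nu_t(\lambda\|\cdot\|_{2,1})^*}\begin{pmatrix}\boldsymbol{u}^{[t]}+\nu_t\mathbf{D}\boldsymbol{v}^{[t+1]}\\ \boldsymbol{\ell}^{[t]}+\nu_t\alpha\mathbf{D}\boldsymbol{h}^{[t+1]}\end{pmatrix},$$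 $$\vartheta_t=(1+2\mu\delta_t)^{-1/2},\qquad \delta_{t+1}=\vartheta_t\delta_t,\qquad \nu_{t+1}=\nu_t/\vartheta_t,$$ $$\begin{pmatrix}\bar{\boldsymbol{u}}^{[t+1]}\\ \bar{\boldsymbol{\ell}}^{[t+1]}\end{pmatrix}=\begin{pmatrix}\boldsymbol{u}^{[t+1]}\\ \boldsymbol{\ell}^{[t+1]}\end{pmatrix}+\vartheta_t\left(\begin{pmatrix}\boldsymbol{u}^{[t+1]}\\ \boldsymbol{\ell}^{[t+1]}\end{pmatrix}-\begin{pmatrix}\boldsymbol{u}^{[t]}\\ \boldsymbol{\ell}^{[t]}\end{pmatrix}\right),$$ where in the second line $\|\cdot\|_{2,1}$ is the mixed norm on $\mathbb{R}^{4\times|\Upsilon|}$, the pair $(\boldsymbol{u},\boldsymbol{\ell})$ being stacked as an element of $\mathbb{R}^{4\times|\Upsilon|}$. Then the sequence $(\boldsymbol{v}^{[t]},\boldsymbol{h}^{[t]})_{t\in\mathbb{N}}$ converges towards a solution of the coupled estimation problem $$\underset{(\boldsymbol{v},\boldsymbol{h})\in\mathbb{R}^{|\Upsilon|}\times\mathbb{R}^{|\Upsilon|}}{\arg\min}\ \Phi(\boldsymbol{v},\boldsymbol{h};\boldsymbol{\mathcal{L}})+\lambda\big\|[\mathbf{D}\boldsymbol{v};\alpha\mathbf{D}\boldsymbol{h}]\big\|_{2,1},$$ where $[\mathbf{D}\boldsymbol{v};\alpha\mathbf{D}\boldsymbol{h}]\in\mathbb{R}^{4\times|\Upsilon|}$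.
   Context: Let $N\geq 2$, $\Upsilon=\{1,\dots,N\}^2$, and let $j_1<j_2$ be positive integers; all sums $\sum_j$ are over $j\in\{j_1,\dots,j_2\}$. For each $j$ let $\boldsymbol{\mathcal{L}}_j=(\mathcal{L}_{j,\underline{n}})_{\underline{n}\in\Upsilon}$ be given with $\mathcal{L}_{j,\underline{n}}>0$ (the wavelet leaders of an image at scale $2^j$); $\log_2$ acts entrywise. Set $R_m=\sum_j j^m$, $\mathbf{J}=\begin{pmatrix}R_0&R_1\\R_1&R_2\end{pmatrix}$ (symmetric positive definite), and $$\Phi(\boldsymbol{v},\boldsymbol{h})=\Phi(\boldsymbol{v},\boldsymbol{h};\boldsymbol{\mathcal{L}})=\frac12\sum_j\|\boldsymbol{v}+j\boldsymbol{h}-\log_2\boldsymbol{\mathcal{L}}_j\|_{\mathrm{Fro}}^2 .$$ The operator $\mathbf{D}:\mathbb{R}^{|\Upsilon|}\to\mathbb{R}^{2\times|\Upsilon|}$ is given by $(\mathbf{D}\boldsymbol{h})_{n_1,n_2}=\begin{pmatrix}h_{n_1,n_2+1}-h_{n_1,n_2}\\ h_{n_1+1,n_2}-h_{n_1,n_2}\end{pmatrix}$ for $1\le n_1,n_2\le N-1$, and $(\mathbf{D}\boldsymbol{h})_{n_1,n_2}=0$ if $n_1=N$ or $n_2=N$. $\mathbf{D}^*$ is its adjoint and $\|\mathbf{D}\|$ its operator norm for Euclidean norms. For $\boldsymbol{z}=(\boldsymbol{z}_1,\dots,\boldsymbol{z}_I)\in\mathbb{R}^{I\times|\Upsilon|}$,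 $$\|\boldsymbol{z}\|_{2,1}=\sum_{n_1=1}^{N-1}\sum_{n_2=1}^{N-1}\sqrt{\sum_{i=1}^I (z_i)_{n_1,n_2}^2}.$$ $\varphi^*$ denotes the Fenchel conjugate of $\varphi$, and $\mathrm{prox}_{\gamma\varphi}(x)=\arg\min_y \frac12\|x-y\|_2^2+\gamma\varphi(y)$ for $\gamma>0$. *)

theory Defs
  imports "HOL-Analysis.Analysis"
begin

text \<open>
  The index set \<open>{1..N}\<close> is represented by an arbitrary finite linearly ordered type
  \<open>'n\<close> with \<open>N = CARD('n)\<close>; the element \<open>n\<close> stands for the number
  \<open>card {..n}\<close>. The three lemmas following the definition of \<open>nxt\<close> justify this
  encoding. The grid is then \<open>'n \<times> 'n\<close>, and the Euclidean norm of the vector type is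
  the Frobenius norm of an image.
\<close>

type_synonym 'n image = "real ^ ('n \<times> 'n)"

definition last_ix :: "'n::{finite,linorder}"
  where "last_ix = Max UNIV"

definition nxt :: "'n::{finite,linorder} \<Rightarrow> 'n"
  where "nxt n = Min {m. n < m}"

lemma index_numbering:
  "bij_betw (\<lambda>n::'n::{finite,linorder}. card {..n}) UNIV {1..CARD('n)}"
proof -
  have sm: "card {..a} < card {..b}" if "a < b" for a b :: 'n
    using that by (intro psubset_card_mono) auto
  then have inj: "inj (\<lambda>n::'n. card {..n})"
    by (metis (mono_tags, lifting) injI less_irrefl linorder_less_linear)
  have "range (\<lambda>n::'n. card {..n}) \<subseteq> {1..CARD('n)}"
    by (auto simp: Suc_le_eq card_gt_0_iff intro!: card_mono)
  moreover have "card (range (\<lambda>n::'n. card {..n})) = card {1..CARD('n)}"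
    using card_image[OF inj] by simp
  ultimately have "range (\<lambda>n::'n. card {..n}) = {1..CARD('n)}"
    by (intro card_subset_eq) auto
  with inj show ?thesis
    by (simp add: bij_betw_def)
qed

lemma card_last_ix: "card {..last_ix :: 'n::{finite,linorder}} = CARD('n)"
proof -
  have "{..last_ix :: 'n} = UNIV"
    by (auto simp: last_ix_def)
  then show ?thesis by simp
qed

lemma card_nxt:
  fixes n :: "'n::{finite,linorder}"
  assumes "n \<noteq> last_ix"
  shows "card {..nxt n} = card {..n} + 1"
proof -
  have "n < last_ix"
    using assms by (simp add: last_ix_def order_less_le)
  then have ne: "{m. n < m} \<noteq> {}" by auto
  have gt: "n < nxt n"
    using Min_in[OF _ ne] by (simp add: nxt_def)
  have le: "nxt n \<le> m" if "n < m" for m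
    using that by (simp add: nxt_def)
  have "{..nxt n} = insert (nxt n) {..n}"
  proof (rule set_eqI)
    fix x
    show "x \<in> {..nxt n} \<longleftrightarrow> x \<in> insert (nxt n) {..n}"
      using gt le[of x] by (cases "x \<le> n") auto
  qed
  then show ?thesis
    using gt by simp
qed

definition grad :: "'n::{finite,linorder} image \<Rightarrow> 'n image ^ 2"
  where "grad h = vector
    [vec_lambda (\<lambda>(n1, n2). if n1 = last_ix \<or> n2 = last_ix then 0 else h $ (n1, nxt n2) - h $ (n1, n2)),
     vec_lambda (\<lambda>(n1, n2). if n1 = last_ix \<or> n2 = last_ix then 0 else h $ (nxt n1, n2) - h $ (n1, n2))]"

definition stack :: "'a::zero ^ 2 \<Rightarrow> 'a ^ 2 \<Rightarrow> 'a ^ 4"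
  where "stack u l = vector [u $ 1, u $ 2, l $ 1, l $ 2]"

lemma stack_nth:
  "stack u l $ 1 = u $ 1" "stack u l $ 2 = u $ 2" "stack u l $ 3 = l $ 1" "stack u l $ 4 = l $ 2"
  by (simp_all add: stack_def vector_def)

text \<open>The last row and the last column are not summed, so this is only a seminorm.\<close>

definition norm21 :: "'n::{finite,linorder} image ^ 'i \<Rightarrow> real"
  where "norm21 z = (\<Sum>n1\<in>{..<last_ix}. \<Sum>n2\<in>{..<last_ix}. sqrt (\<Sum>i\<in>UNIV. (z $ i $ (n1, n2))\<^sup>2))"

definition log2_image :: "'n::finite image \<Rightarrow> 'n image"
  where "log2_image x = (\<chi> n. log 2 (x $ n))"

definition Phi :: "nat \<Rightarrow> nat \<Rightarrow> (nat \<Rightarrow> 'n::finite image) \<Rightarrow> 'n image \<times> 'n image \<Rightarrow> real"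
  where "Phi j1 j2 L = (\<lambda>(v, h). 1/2 * (\<Sum>j=j1..j2. (norm (v + real j *\<^sub>R h - log2_image (L j)))\<^sup>2))"

definition Rmom :: "nat \<Rightarrow> nat \<Rightarrow> nat \<Rightarrow> real"
  where "Rmom j1 j2 m = (\<Sum>j=j1..j2. real j ^ m)"

definition Jmat :: "nat \<Rightarrow> nat \<Rightarrow> real ^ 2 ^ 2"
  where "Jmat j1 j2 = vector [vector [Rmom j1 j2 0, Rmom j1 j2 1], vector [Rmom j1 j2 1, Rmom j1 j2 2]]"

definition is_eigenvalue :: "real ^ 'm ^ 'm \<Rightarrow> real \<Rightarrow> bool"
  where "is_eigenvalue A c \<longleftrightarrow> (\<exists>x. x \<noteq> 0 \<and> A *v x = c *\<^sub>R x)"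

definition is_lowest_eigenvalue :: "real ^ 'm ^ 'm \<Rightarrow> real \<Rightarrow> bool"
  where "is_lowest_eigenvalue A c \<longleftrightarrow> is_eigenvalue A c \<and> (\<forall>d. is_eigenvalue A d \<longrightarrow> c \<le> d)"

definition fenchel_conj :: "('a::real_inner \<Rightarrow> ereal) \<Rightarrow> 'a \<Rightarrow> ereal"
  where "fenchel_conj f y = (SUP x. ereal (x \<bullet> y) - f x)"

definition prox :: "real \<Rightarrow> ('a::real_inner \<Rightarrow> ereal) \<Rightarrow> 'a \<Rightarrow> 'a"
  where "prox c f x = (ARG_MIN (\<lambda>y. ereal (1/2 * (norm (x - y))\<^sup>2) + ereal c * f y) y. True)"

definition coupled_objective ::
    "nat \<Rightarrow> nat \<Rightarrow> (nat \<Rightarrow> 'n::{finite,linorder} image) \<Rightarrow> real \<Rightarrow> real \<Rightarrow> 'n image \<times> 'n image \<Rightarrow> real"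
  where "coupled_objective j1 j2 L lam \<alpha> =
    (\<lambda>(v, h). Phi j1 j2 L (v, h) + lam * norm21 (stack (grad v) (\<alpha> *\<^sub>R grad h)))"

end

theory Submission
  imports Defs
begin

text \<open>
  Write \<open>x = (v, h)\<close>, \<open>K x = [D v; \<alpha> D h]\<close> and \<open>g = \<lambda> \<parallel>\<cdot>\<parallel>\<^sub>2\<^sub>,\<^sub>1\<close>. The data term \<open>\<Phi>\<close> is
  strongly convex with modulus \<open>\<mu>\<close> (\<open>strongly_convex_Phi\<close>), so \<open>\<Phi> + g \<circ> K\<close> has a unique
  minimizer \<open>p\<close>, around which it grows at least like \<open>\<mu>/2 \<parallel>x - p\<parallel>\<^sup>2\<close>. The function \<open>g\<close> is the support
  function of a compact convex set \<open>C\<close> (\<open>norm21_support_function\<close>, \<open>bounded_polar_norm21\<close>), its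
  conjugate is the indicator function of \<open>C\<close>, and the dual proximal step is the projection onto \<open>C\<close>
  (\<open>prox_conj_sublinear\<close>). All dual iterates therefore stay bounded, while \<open>\<delta>\<^sub>t \<longlonglongrightarrow> 0\<close>,
  \<open>\<nu>\<^sub>t \<longlonglongrightarrow> \<infinity>\<close> and \<open>\<delta>\<^sub>t \<nu>\<^sub>t\<close> is constant.

  The projection makes \<open>y\<^sub>t\<^sub>+\<^sub>1\<close> a subgradient of \<open>g\<close> at
  \<open>K x\<^sub>t\<^sub>+\<^sub>1 + (y\<^sub>t - y\<^sub>t\<^sub>+\<^sub>1) / \<nu>\<^sub>t\<close>, hence a subgradient at \<open>K x\<^sub>t\<^sub>+\<^sub>1\<close> up to an error
  \<open>O(1 / \<nu>\<^sub>t) = O(\<delta>\<^sub>t)\<close>. Combined with the three-point inequality of the primal proximal step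
  (\<open>prox_three_point\<close>) this gives, for \<open>e\<^sub>t = x\<^sub>t - p\<close>,
  \<open>(1 + 2 \<mu> \<delta>\<^sub>t) \<parallel>e\<^sub>t\<^sub>+\<^sub>1\<parallel>\<^sup>2 + \<parallel>e\<^sub>t\<^sub>+\<^sub>1 - e\<^sub>t\<parallel>\<^sup>2
     \<le> \<parallel>e\<^sub>t\<parallel>\<^sup>2 + 2 \<delta>\<^sub>t (y\<^sub>t\<^sub>+\<^sub>1 - ybar\<^sub>t) \<bullet> K e\<^sub>t\<^sub>+\<^sub>1 + O(\<delta>\<^sub>t\<^sup>2)\<close>.
  Divide by \<open>\<delta>\<^sub>t\<^sup>2\<close>: since \<open>(1 + 2 \<mu> \<delta>\<^sub>t) / \<delta>\<^sub>t\<^sup>2 = 1 / \<delta>\<^sub>t\<^sub>+\<^sub>1\<^sup>2\<close> and \<open>\<theta>\<^sub>t / \<delta>\<^sub>t\<^sub>+\<^sub>1 = 1 / \<delta>\<^sub>t\<close>,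
  the cross terms telescope up to \<open>(2 / \<delta>\<^sub>t\<^sub>-\<^sub>1) (y\<^sub>t - y\<^sub>t\<^sub>-\<^sub>1) \<bullet> K (e\<^sub>t\<^sub>+\<^sub>1 - e\<^sub>t)\<close>, which Young's
  inequality absorbs into \<open>\<parallel>e\<^sub>t\<^sub>+\<^sub>1 - e\<^sub>t\<parallel>\<^sup>2 / \<delta>\<^sub>t\<^sup>2\<close> and a constant. It follows that
  \<open>\<parallel>e\<^sub>t\<parallel>\<^sup>2 / \<delta>\<^sub>t\<^sup>2\<close> grows at most linearly in \<open>t\<close> (\<open>primal_dual_convergence\<close>), and as \<open>1 / \<delta>\<^sub>t\<close> grows
  at least linearly (\<open>step_sizes\<close>), \<open>\<parallel>e\<^sub>t\<parallel>\<^sup>2 = O(1 / t)\<close>.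
\<close>

section \<open>Strongly convex functions\<close>

text \<open>The convexity inequality with a quadratic gain; no sign is imposed on the modulus, and modulus
  0 is convexity.\<close>

definition strongly_convex :: "real \<Rightarrow> ('a::real_inner \<Rightarrow> real) \<Rightarrow> bool"
  where "strongly_convex m f \<longleftrightarrow>
    (\<forall>x z. \<forall>s\<in>{0..1}. f ((1 - s) *\<^sub>R x + s *\<^sub>R z)
       \<le> (1 - s) * f x + s * f z - m / 2 * (s * (1 - s)) * (norm (x - z))\<^sup>2)"

lemma strongly_convexD:
  "strongly_convex m f \<Longrightarrow> 0 \<le> s \<Longrightarrow> s \<le> 1 \<Longrightarrow>
     f ((1 - s) *\<^sub>R x + s *\<^sub>R z)
       \<le> (1 - s) * f x + s * f z - m / 2 * (s * (1 - s)) * (norm (x - z))\<^sup>2"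
  by (simp add: strongly_convex_def)

lemma strongly_convex_add:
  assumes "strongly_convex a f" "strongly_convex b g"
  shows "strongly_convex (a + b) (\<lambda>x. f x + g x)"
  unfolding strongly_convex_def
proof (intro allI ballI)
  fix x z :: 'a and s :: real assume "s \<in> {0..1}"
  then have "0 \<le> s" "s \<le> 1" by auto
  from strongly_convexD[OF assms(1) this] strongly_convexD[OF assms(2) this]
  show "f ((1 - s) *\<^sub>R x + s *\<^sub>R z) + g ((1 - s) *\<^sub>R x + s *\<^sub>R z)
    \<le> (1 - s) * (f x + g x) + s * (f z + g z) - (a + b) / 2 * (s * (1 - s)) * (norm (x - z))\<^sup>2"
    by (smt (verit) add_divide_distrib distrib_left distrib_right)
qed

lemma strongly_convex_scale:
  assumes "strongly_convex a f" "0 \<le> c"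
  shows "strongly_convex (c * a) (\<lambda>x. c * f x)"
  unfolding strongly_convex_def
proof (intro allI ballI)
  fix x z :: 'a and s :: real assume "s \<in> {0..1}"
  then have "0 \<le> s" "s \<le> 1" by auto
  from mult_left_mono[OF strongly_convexD[OF assms(1) this, of x z] assms(2)]
  show "c * f ((1 - s) *\<^sub>R x + s *\<^sub>R z)
    \<le> (1 - s) * (c * f x) + s * (c * f z) - c * a / 2 * (s * (1 - s)) * (norm (x - z))\<^sup>2"
    by (simp add: algebra_simps)
qed

lemma norm_convex_comb_sq:
  fixes a b :: "'a::real_inner"
  shows "(norm ((1 - s) *\<^sub>R a + s *\<^sub>R b))\<^sup>2
    = (1 - s) * (norm a)\<^sup>2 + s * (norm b)\<^sup>2 - s * (1 - s) * (norm (a - b))\<^sup>2"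
  unfolding power2_norm_eq_inner
  by (simp add: inner_add_left inner_add_right inner_diff_left inner_diff_right inner_commute
      algebra_simps)

lemma strongly_convex_dist_sq:
  fixes w :: "'a::real_inner"
  shows "strongly_convex 1 (\<lambda>y. 1/2 * (norm (w - y))\<^sup>2)"
  unfolding strongly_convex_def
proof (intro allI ballI)
  fix x z :: 'a and s :: real
  have "w - ((1 - s) *\<^sub>R x + s *\<^sub>R z) = (1 - s) *\<^sub>R (w - x) + s *\<^sub>R (w - z)"
    by (simp add: algebra_simps)
  then have eq: "(norm (w - ((1 - s) *\<^sub>R x + s *\<^sub>R z)))\<^sup>2
      = (1 - s) * (norm (w - x))\<^sup>2 + s * (norm (w - z))\<^sup>2 - s * (1 - s) * (norm (x - z))\<^sup>2"
    using norm_convex_comb_sq[of s "w - x" "w - z"] by (simp add: norm_minus_commute)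
  show "1/2 * (norm (w - ((1 - s) *\<^sub>R x + s *\<^sub>R z)))\<^sup>2
    \<le> (1 - s) * (1/2 * (norm (w - x))\<^sup>2) + s * (1/2 * (norm (w - z))\<^sup>2)
        - 1 / 2 * (s * (1 - s)) * (norm (x - z))\<^sup>2"
    unfolding eq by (simp add: field_simps)
qed

text \<open>Nonnegativity replaces an affine minorant and makes coercivity immediate.\<close>

lemma strongly_convex_attains_min:
  fixes f :: "'a::euclidean_space \<Rightarrow> real"
  assumes sc: "strongly_convex m f" and m: "m > 0"
    and nonneg: "\<And>x. 0 \<le> f x" and cont: "continuous_on UNIV f"
  shows "\<exists>p. \<forall>x. f p \<le> f x"
proof -
  define R where "R = sqrt (8 * f 0 / m)"
  have out: "f 0 \<le> f x" if "R < norm x" for x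
  proof -
    have "8 * f 0 / m = R\<^sup>2"
      unfolding R_def using m nonneg[of 0] by simp
    also have "\<dots> \<le> (norm x)\<^sup>2"
      using that nonneg[of 0] m by (intro power_mono) (auto simp: R_def)
    finally have far: "8 * f 0 \<le> m * (norm x)\<^sup>2"
      using m by (simp add: field_simps)
    \<comment> \<open>Convexity at the midpoint of 0 and \<open>x\<close>, where \<open>f\<close> is nonnegative.\<close>
    have "0 \<le> f ((1 - 1/2) *\<^sub>R 0 + (1/2) *\<^sub>R x)" by (rule nonneg)
    also have "\<dots> \<le> (1 - 1/2) * f 0 + 1/2 * f x - m / 2 * (1/2 * (1 - 1/2)) * (norm (0 - x))\<^sup>2"
      by (rule strongly_convexD[OF sc]) auto
    finally show ?thesis using far by simp
  qed
  have R0: "0 \<le> R"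
    using m nonneg[of 0] by (simp add: R_def)
  have "\<exists>p\<in>cball 0 R. \<forall>x\<in>cball 0 R. f p \<le> f x"
    using R0 by (intro continuous_attains_inf continuous_on_subset[OF cont]) auto
  then obtain p where "\<forall>x\<in>cball 0 R. f p \<le> f x" by blast
  then have p: "f p \<le> f x" if "norm x \<le> R" for x
    using that by simp
  have "f p \<le> f x" for x
    using p[of x] p[of 0] out[of x] R0 by (cases "norm x \<le> R") auto
  then show ?thesis by blast
qed

lemma strongly_convex_min_growth:
  fixes f :: "'a::real_inner \<Rightarrow> real"
  assumes sc: "strongly_convex m f" and min: "\<And>x. f p \<le> f x"
  shows "f p + m / 2 * (norm (z - p))\<^sup>2 \<le> f z"
proof -
  \<comment> \<open>Compare \<open>p\<close> with the points of the segment towards \<open>z\<close>, divide by \<open>s\<close>, and let \<open>s\<close> tend to 0.\<close>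
  have ev: "\<forall>\<^sub>F s in at_right 0. m / 2 * (1 - s) * (norm (p - z))\<^sup>2 \<le> f z - f p"
    unfolding eventually_at_right_field
  proof (intro exI[of _ 1] conjI allI impI)
    fix s :: real assume s: "0 < s" "s < 1"
    have "f p \<le> (1 - s) * f p + s * f z - m / 2 * (s * (1 - s)) * (norm (p - z))\<^sup>2"
      using min[of "(1 - s) *\<^sub>R p + s *\<^sub>R z"] strongly_convexD[OF sc, of s p z] s by simp
    then have "s * (m / 2 * (1 - s) * (norm (p - z))\<^sup>2) \<le> s * (f z - f p)"
      by (simp add: algebra_simps)
    then show "m / 2 * (1 - s) * (norm (p - z))\<^sup>2 \<le> f z - f p"
      using s by simp
  qed simp
  have "((\<lambda>s::real. m / 2 * (1 - s) * (norm (p - z))\<^sup>2) \<longlongrightarrow> m / 2 * (1 - 0) * (norm (p - z))\<^sup>2)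
      (at_right 0)"
    by (intro tendsto_intros)
  from tendsto_upperbound[OF this ev] show ?thesis
    by (simp add: norm_minus_commute)
qed

section \<open>The two proximal steps\<close>

text \<open>\<^const>\<open>prox\<close> is a choice among the minimizers, so it minimizes as soon as a minimizer
  exists.\<close>

lemma prox_is_arg_min:
  assumes "\<exists>p. is_arg_min (\<lambda>y. ereal (1/2 * (norm (x - y))\<^sup>2) + ereal c * f y) (\<lambda>_. True) p"
  shows "is_arg_min (\<lambda>y. ereal (1/2 * (norm (x - y))\<^sup>2) + ereal c * f y) (\<lambda>_. True) (prox c f x)"
  using someI_ex[OF assms] by (simp add: prox_def arg_min_def)

text \<open>The function minimized by the proximal step is strongly convex with modulus \<open>1 + c * m\<close>; the
  inequality is its quadratic growth at the minimizer.\<close>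

lemma prox_three_point:
  fixes f :: "'a::euclidean_space \<Rightarrow> real"
  assumes sc: "strongly_convex m f" and "m > 0" "c > 0"
    and nonneg: "\<And>x. 0 \<le> f x" and cont: "continuous_on UNIV f"
    and p: "p = prox c (\<lambda>x. ereal (f x)) (x - c *\<^sub>R g)"
  shows "(1 + c * m) * (norm (p - z))\<^sup>2 + (norm (p - x))\<^sup>2
    \<le> (norm (x - z))\<^sup>2 + 2 * c * (f z - f p + g \<bullet> (z - p))"
proof -
  define w where "w = x - c *\<^sub>R g"
  define F where "F = (\<lambda>y. 1/2 * (norm (w - y))\<^sup>2 + c * f y)"
  have scF: "strongly_convex (1 + c * m) F"
    unfolding F_def using \<open>c > 0\<close>
    by (intro strongly_convex_add strongly_convex_dist_sq strongly_convex_scale sc) auto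
  have "\<exists>q. \<forall>y. F q \<le> F y"
  proof (rule strongly_convex_attains_min[OF scF])
    show "1 + c * m > 0"
      using \<open>m > 0\<close> \<open>c > 0\<close> by (simp add: add_pos_pos)
    show "0 \<le> F y" for y
      using \<open>c > 0\<close> nonneg by (simp add: F_def)
    show "continuous_on UNIV F"
      unfolding F_def by (intro continuous_intros cont)
  qed
  then have "\<exists>q. is_arg_min (\<lambda>y. ereal (1/2 * (norm (w - y))\<^sup>2) + ereal c * ereal (f y)) (\<lambda>_. True) q"
    by (simp add: is_arg_min_linorder F_def)
  from prox_is_arg_min[OF this] have "F p \<le> F y" for y
    by (simp add: p is_arg_min_linorder F_def w_def)
  from strongly_convex_min_growth[OF scF this, of z]
  have "1/2 * (norm (w - p))\<^sup>2 + c * f p + (1 + c * m) / 2 * (norm (z - p))\<^sup>2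
      \<le> 1/2 * (norm (w - z))\<^sup>2 + c * f z"
    by (simp add: F_def)
  moreover have "(norm (w - z))\<^sup>2 - (norm (w - p))\<^sup>2
      = (norm (x - z))\<^sup>2 - (norm (p - x))\<^sup>2 + 2 * c * (g \<bullet> (z - p))"
    unfolding power2_norm_eq_inner w_def
    by (simp add: inner_add_left inner_add_right inner_diff_left inner_diff_right inner_commute
        algebra_simps)
  ultimately show ?thesis
    unfolding norm_minus_commute[of p z] by argo
qed

text \<open>The set of linear functionals, represented by vectors, that lie below \<open>g\<close>. For a sublinear
  \<open>g\<close> it is the subdifferential of \<open>g\<close> at 0; for a norm it is the unit ball of the dual norm.\<close>

definition polar :: "('b::real_inner \<Rightarrow> real) \<Rightarrow> 'b set"
  where "polar g = {c. \<forall>z. c \<bullet> z \<le> g z}"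

lemma closed_polar: "closed (polar g)"
proof -
  have "polar g = (\<Inter>z. {c. z \<bullet> c \<le> g z})"
    by (auto simp: polar_def inner_commute)
  then show ?thesis by (auto intro!: closed_INT closed_halfspace_le)
qed

lemma convex_polar: "convex (polar g)"
proof -
  have "polar g = (\<Inter>z. {c. z \<bullet> c \<le> g z})"
    by (auto simp: polar_def inner_commute)
  then show ?thesis by (auto intro!: convex_INT convex_halfspace_le)
qed

lemma fenchel_conj_sublinear:
  fixes g :: "'b::real_inner \<Rightarrow> real"
  assumes hom: "\<And>c z. 0 \<le> c \<Longrightarrow> g (c *\<^sub>R z) = c * g z"
  shows "fenchel_conj (\<lambda>z. ereal (g z)) y = (if y \<in> polar g then 0 else \<infinity>)"
proof (cases "y \<in> polar g")
  case True
  have "g 0 = 0" using hom[of 0 0] by simp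
  show ?thesis
    unfolding fenchel_conj_def using True
    by (auto intro!: antisym SUP_least SUP_upper2[of 0] simp: polar_def inner_commute \<open>g 0 = 0\<close>)
next
  case False
  then obtain z where z: "g z < y \<bullet> z" by (auto simp: polar_def not_le)
  have "fenchel_conj (\<lambda>z. ereal (g z)) y = \<infinity>"
    unfolding fenchel_conj_def
  proof (rule SUP_PInfty)
    fix n :: nat
    \<comment> \<open>Scaling \<open>z\<close> by this factor makes the supremand equal to \<open>n\<close>.\<close>
    define c where "c = real n / (y \<bullet> z - g z)"
    have "0 \<le> c" using z by (simp add: c_def)
    then have "c *\<^sub>R z \<bullet> y - g (c *\<^sub>R z) = c * (y \<bullet> z - g z)"
      by (simp add: hom inner_commute algebra_simps)
    also have "\<dots> = real n" using z by (simp add: c_def)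
    finally show "\<exists>i\<in>UNIV. ereal (real n) \<le> ereal (i \<bullet> y) - ereal (g i)"
      by (intro bexI[of _ "c *\<^sub>R z"]) auto
  qed
  with False show ?thesis by simp
qed

text \<open>By \<open>fenchel_conj_sublinear\<close> the proximal point is the projection of \<open>w\<close> onto the polar set,
  which the two conclusions characterize.\<close>

lemma prox_conj_sublinear:
  fixes g :: "'b::euclidean_space \<Rightarrow> real"
  assumes hom: "\<And>c z. 0 \<le> c \<Longrightarrow> g (c *\<^sub>R z) = c * g z"
    and nonneg: "\<And>z. 0 \<le> g z" and "c > 0"
    and p: "p = prox c (fenchel_conj (\<lambda>z. ereal (g z))) w"
  shows "p \<in> polar g" "\<And>q. q \<in> polar g \<Longrightarrow> (w - p) \<bullet> (q - p) \<le> 0"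
proof -
  let ?F = "\<lambda>y. ereal (1/2 * (norm (w - y))\<^sup>2) + ereal c * fenchel_conj (\<lambda>z. ereal (g z)) y"
  have F: "?F y = (if y \<in> polar g then ereal (1/2 * (norm (w - y))\<^sup>2) else \<infinity>)" for y
    using \<open>c > 0\<close> by (simp add: fenchel_conj_sublinear hom)
  have 0: "0 \<in> polar g" using nonneg by (simp add: polar_def)
  define a where "a = closest_point (polar g) w"
  have a: "a \<in> polar g" "\<And>y. y \<in> polar g \<Longrightarrow> norm (w - a) \<le> norm (w - y)"
    using closest_point_exists[OF closed_polar, of g w] 0 by (auto simp: a_def dist_norm)
  have "is_arg_min ?F (\<lambda>_. True) a"
    unfolding is_arg_min_linorder F using a by (auto intro!: power_mono)
  then have "is_arg_min ?F (\<lambda>_. True) p"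
    unfolding p by (intro prox_is_arg_min exI)
  then have min: "?F p \<le> ?F y" for y
    unfolding is_arg_min_linorder by blast
  show pin: "p \<in> polar g"
    using min[of 0] unfolding F using 0 by (auto split: if_splits)
  have near: "\<forall>y\<in>polar g. dist w p \<le> dist w y"
  proof
    fix y assume "y \<in> polar g"
    then have "(norm (w - p))\<^sup>2 \<le> (norm (w - y))\<^sup>2"
      using min[of y] unfolding F using pin by simp
    then show "dist w p \<le> dist w y"
      by (simp add: dist_norm power2_le_iff_abs_le)
  qed
  show "(w - p) \<bullet> (q - p) \<le> 0" if "q \<in> polar g" for q
    by (rule any_closest_point_dot[OF convex_polar closed_polar pin that near])
qed

section \<open>Step sizes\<close>

text \<open>The recursion \<open>1 / \<delta>\<^sub>t\<^sub>+\<^sub>1\<^sup>2 = 1 / \<delta>\<^sub>t\<^sup>2 + 2 \<mu> / \<delta>\<^sub>t\<close> makes \<open>1 / \<delta>\<^sub>t\<close> grow at least linearly,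
  so that \<open>\<delta>\<^sub>t\<^sup>2\<close> times an affine function of \<open>t\<close> tends to 0.\<close>

lemma step_sizes:
  fixes \<delta> :: "nat \<Rightarrow> real"
  assumes \<mu>: "\<mu> > 0" and \<delta>0: "\<delta> 0 > 0"
    and \<theta>: "\<And>t. \<theta> t = (1 + 2 * \<mu> * \<delta> t) powr (- 1/2)"
    and \<delta>: "\<And>t. \<delta> (Suc t) = \<theta> t * \<delta> t"
  shows "\<delta> t > 0" "0 < \<theta> t" "\<theta> t \<le> 1"
    and "(1 / \<delta> (Suc t))\<^sup>2 = (1 + 2 * \<mu> * \<delta> t) * (1 / \<delta> t)\<^sup>2"
    and "(\<lambda>t. (a + b * real t) * (\<delta> t)\<^sup>2) \<longlonglongrightarrow> 0"
proof -
  have pos: "\<delta> t > 0" for t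
  proof (induction t)
    case (Suc t)
    then have "0 < 1 + 2 * \<mu> * \<delta> t" using \<mu> by (simp add: add_pos_pos)
    with Suc show ?case by (simp add: \<delta> \<theta>)
  qed (rule \<delta>0)
  show "\<delta> t > 0" by (rule pos)
  have gt1: "1 < 1 + 2 * \<mu> * \<delta> t" for t using \<mu> pos[of t] by simp
  show "0 < \<theta> t" using gt1[of t] by (simp add: \<theta>)
  have th: "\<theta> t = 1 / sqrt (1 + 2 * \<mu> * \<delta> t)" for t
    unfolding \<theta> using gt1[of t] by (simp add: powr_minus powr_half_sqrt inverse_eq_divide)
  show "\<theta> t \<le> 1" using gt1[of t] unfolding th by simp
  have rec: "(1 / \<delta> (Suc t))\<^sup>2 = (1 + 2 * \<mu> * \<delta> t) * (1 / \<delta> t)\<^sup>2" for t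
    unfolding \<delta> th using gt1[of t] pos[of t] by (simp add: power_divide power_mult_distrib)
  show "(1 / \<delta> (Suc t))\<^sup>2 = (1 + 2 * \<mu> * \<delta> t) * (1 / \<delta> t)\<^sup>2" by (rule rec)
  define r where "r = (\<lambda>t. 1 / \<delta> t)"
  have rpos: "r t > 0" for t using pos by (simp add: r_def)
  have rrec: "(r (Suc t))\<^sup>2 = (r t)\<^sup>2 + 2 * \<mu> * r t" for t
    using rec[of t] pos[of t] by (simp add: r_def algebra_simps power2_eq_square)
  have rmono: "r 0 \<le> r t" for t
  proof (induction t)
    case (Suc t)
    have "(r t)\<^sup>2 \<le> (r (Suc t))\<^sup>2" using rrec[of t] \<mu> rpos[of t] by simp
    then have "r t \<le> r (Suc t)" using rpos[of "Suc t"] by (simp add: power2_le_iff_abs_le)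
    with Suc show ?case by simp
  qed simp
  \<comment> \<open>The increment \<open>2 * \<mu> * r t / (r (Suc t) + r t)\<close> is at least \<open>2 * \<mu> * r t / (2 * r t + \<mu>)\<close>,
    which is increasing in \<open>r t\<close>.\<close>
  define c where "c = 2 * \<mu> * r 0 / (2 * r 0 + \<mu>)"
  have cpos: "c > 0" using \<mu> rpos[of 0] by (simp add: c_def)
  have step: "r t + c \<le> r (Suc t)" for t
  proof -
    have "(r (Suc t))\<^sup>2 \<le> (r t + \<mu>)\<^sup>2"
      using rrec[of t] by (simp add: power2_eq_square algebra_simps)
    then have "r (Suc t) \<le> r t + \<mu>"
      using \<mu> rpos[of t] by (simp add: power2_le_iff_abs_le)
    then have "r (Suc t) + r t \<le> 2 * r t + \<mu>" by simp
    moreover have "(r (Suc t) - r t) * (r (Suc t) + r t) = 2 * \<mu> * r t"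
      using rrec[of t] by (simp add: power2_eq_square algebra_simps)
    moreover have "c \<le> 2 * \<mu> * r t / (2 * r t + \<mu>)"
      using \<mu> rpos[of t] rpos[of 0] rmono[of t] by (simp add: c_def field_simps)
    moreover have "r (Suc t) - r t = 2 * \<mu> * r t / (r (Suc t) + r t)"
      using calculation(2) rpos[of t] rpos[of "Suc t"] by (simp add: field_simps)
    moreover have "2 * \<mu> * r t / (2 * r t + \<mu>) \<le> 2 * \<mu> * r t / (r (Suc t) + r t)"
      using calculation(1) \<mu> rpos[of t] rpos[of "Suc t"] by (intro divide_left_mono) auto
    ultimately show ?thesis by linarith
  qed
  have lin: "c * real t \<le> r t" for t
  proof (induction t)
    case 0 then show ?case using rpos[of 0] by simp
  next
    case (Suc t) then show ?case using step[of t] by (simp add: algebra_simps)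
  qed
  have bound: "\<bar>(a + b * real t) * (\<delta> t)\<^sup>2\<bar> \<le> (\<bar>a\<bar> + \<bar>b\<bar>) / c\<^sup>2 * (1 / real t)" if "t > 0" for t
  proof -
    have "\<delta> t \<le> 1 / (c * real t)"
      using lin[of t] that cpos pos[of t] by (simp add: r_def field_simps)
    then have "(\<delta> t)\<^sup>2 \<le> (1 / (c * real t))\<^sup>2"
      using pos[of t] by (intro power_mono) auto
    moreover have "\<bar>a + b * real t\<bar> \<le> (\<bar>a\<bar> + \<bar>b\<bar>) * real t"
    proof -
      have "\<bar>a + b * real t\<bar> \<le> \<bar>a\<bar> + \<bar>b\<bar> * real t"
        using abs_triangle_ineq[of a "b * real t"] by (simp add: abs_mult)
      moreover have "\<bar>a\<bar> * 1 \<le> \<bar>a\<bar> * real t"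
        using that by (intro mult_left_mono) auto
      ultimately show ?thesis by (simp add: algebra_simps)
    qed
    ultimately have "\<bar>a + b * real t\<bar> * (\<delta> t)\<^sup>2 \<le> (\<bar>a\<bar> + \<bar>b\<bar>) * real t * (1 / (c * real t))\<^sup>2"
      by (intro mult_mono) auto
    also have "\<dots> = (\<bar>a\<bar> + \<bar>b\<bar>) / c\<^sup>2 * (1 / real t)"
      using that cpos by (simp add: field_simps power2_eq_square)
    finally show ?thesis by (simp add: abs_mult)
  qed
  have "(\<lambda>t. (\<bar>a\<bar> + \<bar>b\<bar>) / c\<^sup>2 * (1 / real t)) \<longlonglongrightarrow> (\<bar>a\<bar> + \<bar>b\<bar>) / c\<^sup>2 * 0"
    by (intro tendsto_intros lim_1_over_n)
  then have "(\<lambda>t. (\<bar>a\<bar> + \<bar>b\<bar>) / c\<^sup>2 * (1 / real t)) \<longlonglongrightarrow> 0" by simp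
  then show "(\<lambda>t. (a + b * real t) * (\<delta> t)\<^sup>2) \<longlonglongrightarrow> 0"
    by (rule Lim_null_comparison[rotated])
       (use bound in \<open>auto intro!: eventually_sequentiallyI[of 1]\<close>)
qed

section \<open>Convergence of the accelerated primal-dual iteration\<close>

text \<open>
  The iteration enters only through inequalities: \<open>primal\<close> is the three-point inequality of the
  primal proximal step at \<open>p\<close>, while \<open>dual_mem\<close> and \<open>dual\<close> describe the projection onto the
  polar set of \<open>g\<close>. The hypothesis \<open>supp\<close> says that \<open>g\<close> is the support function of that set.
\<close>

lemma primal_dual_convergence:
  fixes x :: "nat \<Rightarrow> 'a::real_inner" and y ybar :: "nat \<Rightarrow> 'b::real_inner"
    and K :: "'a \<Rightarrow> 'b" and f :: "'a \<Rightarrow> real" and g :: "'b \<Rightarrow> real"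
  assumes K: "bounded_linear K"
    and \<mu>: "\<mu> > 0" and \<delta>0: "\<delta> 0 > 0" and \<nu>0: "\<nu> 0 > 0"
    and \<theta>: "\<And>t. \<theta> t = (1 + 2 * \<mu> * \<delta> t) powr (- 1/2)"
    and \<delta>: "\<And>t. \<delta> (Suc t) = \<theta> t * \<delta> t"
    and \<nu>: "\<And>t. \<nu> (Suc t) = \<nu> t / \<theta> t"
    and bdd: "bounded (polar g)"
    and supp: "\<And>z. \<exists>c\<in>polar g. c \<bullet> z = g z"
    and min: "\<And>z. f p + g (K p) + \<mu> / 2 * (norm (z - p))\<^sup>2 \<le> f z + g (K z)"
    and primal: "\<And>t. (1 + \<delta> t * \<mu>) * (norm (x (Suc t) - p))\<^sup>2 + (norm (x (Suc t) - x t))\<^sup>2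
       \<le> (norm (x t - p))\<^sup>2 + 2 * \<delta> t * (f p - f (x (Suc t)) + ybar t \<bullet> K (p - x (Suc t)))"
    and dual_mem: "\<And>t. y (Suc t) \<in> polar g"
    and dual: "\<And>t q. q \<in> polar g \<Longrightarrow>
       (y t + \<nu> t *\<^sub>R K (x (Suc t)) - y (Suc t)) \<bullet> (q - y (Suc t)) \<le> 0"
    and ybar: "\<And>t. ybar (Suc t) = y (Suc t) + \<theta> t *\<^sub>R (y (Suc t) - y t)"
  shows "x \<longlonglongrightarrow> p"
proof -
  note step = step_sizes[of \<mu> \<delta> \<theta>, OF \<mu> \<delta>0 \<theta> \<delta>]
  interpret K: bounded_linear K by (rule K)
  obtain B0 where B0: "\<And>c. c \<in> polar g \<Longrightarrow> norm c \<le> B0"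
    using bdd by (auto simp: bounded_iff)
  define B where "B = max B0 (norm (y 0))"
  have B: "norm c \<le> B" if "c \<in> polar g" for c using B0[OF that] by (simp add: B_def)
  have yB: "norm (y t) \<le> B" for t
    by (cases t) (auto simp: B_def intro: B0[OF dual_mem] max.coboundedI1)
  have Bpos: "0 \<le> B" using yB[of 0] norm_ge_zero[of "y 0"] by linarith
  obtain k where k: "k > 0" "\<And>z. norm (K z) \<le> k * norm z"
    using K.pos_bounded by (auto simp: mult.commute)
  have prod: "\<delta> t * \<nu> t = \<delta> 0 * \<nu> 0" for t
    by (induction t) (use step(2) in \<open>auto simp: \<delta> \<nu> less_imp_neq[THEN not_sym]\<close>)
  have \<nu>pos: "\<nu> t > 0" for t
    using prod[of t] step(1)[of t] \<delta>0 \<nu>0 by (metis mult_pos_pos zero_less_mult_pos)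
  define e where "e t = x t - p" for t
  define d where "d t = y (Suc t) - y t" for t
  have dB: "norm (d t) \<le> 2 * B" for t
    using norm_triangle_ineq4[of "y (Suc t)" "y t"] yB[of t] yB[of "Suc t"] by (simp add: d_def)
  \<comment> \<open>\<open>y (Suc t)\<close> is an approximate subgradient of \<open>g\<close> at \<open>K (x (Suc t))\<close>, tested against \<open>K p\<close>.\<close>
  have sub: "g (K (x (Suc t))) - g (K p) - 4 * B\<^sup>2 / \<nu> t \<le> y (Suc t) \<bullet> K (e (Suc t))" for t
  proof -
    let ?X = "K (x (Suc t))"
    define \<epsilon> where "\<epsilon> = (1 / \<nu> t) *\<^sub>R (y t - y (Suc t))"
    have \<epsilon>B: "norm \<epsilon> \<le> 2 * B / \<nu> t"
      using dB[of t] \<nu>pos[of t]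
      by (simp add: \<epsilon>_def d_def norm_minus_commute divide_right_mono)
    obtain c where c: "c \<in> polar g" "c \<bullet> ?X = g ?X" using supp by blast
    have "\<nu> t *\<^sub>R (?X + \<epsilon>) = y t + \<nu> t *\<^sub>R ?X - y (Suc t)"
      using \<nu>pos[of t] by (simp add: \<epsilon>_def scaleR_add_right)
    then have "(\<nu> t *\<^sub>R (?X + \<epsilon>)) \<bullet> (c - y (Suc t)) \<le> 0"
      using dual[OF c(1), of t] by (simp only:)
    then have "(?X + \<epsilon>) \<bullet> (c - y (Suc t)) \<le> 0"
      using \<nu>pos[of t] by (simp add: mult_le_0_iff)
    then have 1: "g ?X + c \<bullet> \<epsilon> - y (Suc t) \<bullet> \<epsilon> \<le> y (Suc t) \<bullet> ?X"
      using c(2) by (simp add: inner_add_right inner_diff_right inner_commute[of _ c]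
          inner_commute[of _ "y (Suc t)"])
    have small: "\<bar>a \<bullet> \<epsilon>\<bar> \<le> 2 * B\<^sup>2 / \<nu> t" if "norm a \<le> B" for a
    proof -
      have "\<bar>a \<bullet> \<epsilon>\<bar> \<le> norm a * norm \<epsilon>" by (rule Cauchy_Schwarz_ineq2)
      also have "\<dots> \<le> B * (2 * B / \<nu> t)"
        using that \<epsilon>B Bpos by (intro mult_mono) auto
      finally show ?thesis by (simp add: power2_eq_square algebra_simps)
    qed
    have 2: "y (Suc t) \<bullet> K p \<le> g (K p)"
      using dual_mem[of t] by (simp add: polar_def)
    show ?thesis
      using 1 2 small[OF B[OF c(1)]] small[OF yB[of "Suc t"]]
      by (simp add: e_def K.diff inner_diff_right)
  qed
  have descent: "(1 + 2 * \<mu> * \<delta> t) * (norm (e (Suc t)))\<^sup>2 + (norm (e (Suc t) - e t))\<^sup>2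
      \<le> (norm (e t))\<^sup>2 + 2 * \<delta> t * ((y (Suc t) - ybar t) \<bullet> K (e (Suc t))) + 8 * B\<^sup>2 * (\<delta> t / \<nu> t)"
    for t
  proof -
    have "f p - f (x (Suc t)) + ybar t \<bullet> K (p - x (Suc t))
        \<le> (y (Suc t) - ybar t) \<bullet> K (e (Suc t)) + 4 * B\<^sup>2 / \<nu> t - \<mu> / 2 * (norm (e (Suc t)))\<^sup>2"
      using min[of "x (Suc t)"] sub[of t]
      by (simp add: e_def K.diff inner_diff_right inner_diff_left)
    then have "2 * \<delta> t * (f p - f (x (Suc t)) + ybar t \<bullet> K (p - x (Suc t)))
        \<le> 2 * \<delta> t * ((y (Suc t) - ybar t) \<bullet> K (e (Suc t)) + 4 * B\<^sup>2 / \<nu> t - \<mu> / 2 * (norm (e (Suc t)))\<^sup>2)"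
      using step(1)[of t] by (intro mult_left_mono) auto
    with primal[of t] show ?thesis
      by (simp add: e_def algebra_simps)
  qed
  define r where "r t = 1 / \<delta> t" for t
  have rpos: "r t > 0" for t using step(1)[of t] by (simp add: r_def)
  have r\<theta>: "\<theta> t * r (Suc t) = r t" for t
    using step(1)[of t] step(2)[of t] by (simp add: r_def \<delta>)
  have rle: "r t \<le> r (Suc t)" for t
    using r\<theta>[of t] step(3)[of t] rpos[of "Suc t"] mult_right_mono[of "\<theta> t" 1 "r (Suc t)"] by simp
  define M where "M = 4 * B\<^sup>2 * k\<^sup>2 + 8 * B\<^sup>2 / (\<delta> 0 * \<nu> 0)"
  \<comment> \<open>The weighted squared distance, corrected by the telescoping cross term.\<close>
  define W where "W t = (r (Suc t))\<^sup>2 * (norm (e (Suc t)))\<^sup>2 - 2 * r t * (d t \<bullet> K (e (Suc t)))" for t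
  have young: "2 * r t * \<bar>d t \<bullet> K z\<bar> \<le> a * (r (Suc t))\<^sup>2 * (norm z)\<^sup>2 + 4 * B\<^sup>2 * k\<^sup>2 / a"
    if a: "a > 0" for t z and a :: real
  proof -
    have "\<bar>d t \<bullet> K z\<bar> \<le> norm (d t) * norm (K z)" by (rule Cauchy_Schwarz_ineq2)
    also have "\<dots> \<le> (2 * B) * (k * norm z)"
      using dB k(2) Bpos by (intro mult_mono) auto
    finally have "2 * r t * \<bar>d t \<bullet> K z\<bar> \<le> 2 * r (Suc t) * ((2 * B) * (k * norm z))"
      using rle[of t] rpos[of t] by (intro mult_mono) auto
    also have "\<dots> = 2 * (sqrt a * r (Suc t) * norm z) * (2 * B * k / sqrt a)"
      using a by simp
    also have "\<dots> \<le> (sqrt a * r (Suc t) * norm z)\<^sup>2 + (2 * B * k / sqrt a)\<^sup>2"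
      by (rule sum_squares_bound)
    also have "\<dots> = a * (r (Suc t))\<^sup>2 * (norm z)\<^sup>2 + 4 * B\<^sup>2 * k\<^sup>2 / a"
      using a by (simp add: power_mult_distrib power_divide)
    finally show ?thesis .
  qed
  have Wstep: "W (Suc t) \<le> W t + M" for t
  proof -
    let ?s = "Suc t" and ?n = "Suc (Suc t)"
    have rd: "(r ?s)\<^sup>2 * \<delta> ?s = r ?s"
      using step(1)[of ?s] by (simp add: r_def power2_eq_square)
    have c0: "(r ?s)\<^sup>2 * (\<delta> ?s / \<nu> ?s) = 1 / (\<delta> 0 * \<nu> 0)"
      using step(1)[of ?s] \<nu>pos[of ?s] prod[of ?s, symmetric]
      by (simp add: r_def power2_eq_square)
    have "(r ?s)\<^sup>2 * ((1 + 2 * \<mu> * \<delta> ?s) * (norm (e ?n))\<^sup>2 + (norm (e ?n - e ?s))\<^sup>2)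
       \<le> (r ?s)\<^sup>2 * ((norm (e ?s))\<^sup>2 + 2 * \<delta> ?s * ((y ?n - ybar ?s) \<bullet> K (e ?n)) + 8 * B\<^sup>2 * (\<delta> ?s / \<nu> ?s))"
      by (rule mult_left_mono[OF descent]) simp
    also have "\<dots> = (r ?s)\<^sup>2 * (norm (e ?s))\<^sup>2 + 2 * ((r ?s)\<^sup>2 * \<delta> ?s) * ((y ?n - ybar ?s) \<bullet> K (e ?n))
         + 8 * B\<^sup>2 * ((r ?s)\<^sup>2 * (\<delta> ?s / \<nu> ?s))"
      by (simp add: algebra_simps)
    also have "\<dots> = (r ?s)\<^sup>2 * (norm (e ?s))\<^sup>2 + 2 * r ?s * ((y ?n - ybar ?s) \<bullet> K (e ?n))
         + 8 * B\<^sup>2 / (\<delta> 0 * \<nu> 0)"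
      unfolding rd c0 by simp
    finally have main: "(r ?s)\<^sup>2 * ((1 + 2 * \<mu> * \<delta> ?s) * (norm (e ?n))\<^sup>2 + (norm (e ?n - e ?s))\<^sup>2)
       \<le> (r ?s)\<^sup>2 * (norm (e ?s))\<^sup>2 + 2 * r ?s * ((y ?n - ybar ?s) \<bullet> K (e ?n)) + 8 * B\<^sup>2 / (\<delta> 0 * \<nu> 0)" .
    have lhs: "(r ?s)\<^sup>2 * ((1 + 2 * \<mu> * \<delta> ?s) * (norm (e ?n))\<^sup>2 + (norm (e ?n - e ?s))\<^sup>2)
       = (r ?n)\<^sup>2 * (norm (e ?n))\<^sup>2 + (r ?s)\<^sup>2 * (norm (e ?n - e ?s))\<^sup>2"
      using step(4)[of ?s] by (simp add: r_def algebra_simps)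
    have "y ?n - ybar ?s = d ?s - \<theta> t *\<^sub>R d t" by (simp add: ybar d_def)
    then have "r ?s * ((y ?n - ybar ?s) \<bullet> K (e ?n))
        = r ?s * (d ?s \<bullet> K (e ?n)) - (\<theta> t * r ?s) * (d t \<bullet> K (e ?n))"
      by (simp only: inner_diff_left inner_scaleR_left) (simp add: algebra_simps)
    also have "\<dots> = r ?s * (d ?s \<bullet> K (e ?n)) - r t * (d t \<bullet> K (e ?s)) - r t * (d t \<bullet> K (e ?n - e ?s))"
      unfolding r\<theta> by (simp add: K.diff inner_diff_right algebra_simps)
    finally have split: "r ?s * ((y ?n - ybar ?s) \<bullet> K (e ?n)) =
        r ?s * (d ?s \<bullet> K (e ?n)) - r t * (d t \<bullet> K (e ?s)) - r t * (d t \<bullet> K (e ?n - e ?s))" .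
    \<comment> \<open>The remainder is absorbed by the squared increment in \<open>main\<close>.\<close>
    have "- (r t * (d t \<bullet> K (e ?n - e ?s))) \<le> r t * \<bar>d t \<bullet> K (e ?n - e ?s)\<bar>"
      using rpos[of t] by (metis abs_ge_minus_self abs_mult abs_of_pos)
    with young[of 1 t "e ?n - e ?s"]
    have "- 2 * (r t * (d t \<bullet> K (e ?n - e ?s))) \<le> (r ?s)\<^sup>2 * (norm (e ?n - e ?s))\<^sup>2 + 4 * B\<^sup>2 * k\<^sup>2"
      by simp
    with main lhs split show ?thesis by (simp add: W_def M_def)
  qed
  have Wle: "W t \<le> W 0 + M * real t" for t
  proof (induction t)
    case (Suc t) then show ?case using Wstep[of t] by (simp add: algebra_simps)
  qed simp
  have rate: "(norm (e (Suc t)))\<^sup>2 \<le> ((2 * W 0 + 16 * B\<^sup>2 * k\<^sup>2 - 2 * M) + 2 * M * real (Suc t)) * (\<delta> (Suc t))\<^sup>2"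
    for t
  proof -
    have "r t * (d t \<bullet> K (e (Suc t))) \<le> r t * \<bar>d t \<bullet> K (e (Suc t))\<bar>"
      using rpos[of t] by (intro mult_left_mono) auto
    with young[of "1/2" t "e (Suc t)"] Wle[of t]
    have "(r (Suc t))\<^sup>2 * (norm (e (Suc t)))\<^sup>2 \<le> 2 * W 0 + 16 * B\<^sup>2 * k\<^sup>2 + 2 * M * real t"
      by (simp add: W_def)
    then show ?thesis
      using step(1)[of "Suc t"] by (simp add: r_def field_simps)
  qed
  have "(\<lambda>t. (norm (e (Suc t)))\<^sup>2) \<longlonglongrightarrow> 0"
    by (rule Lim_null_comparison[OF _ LIMSEQ_Suc[OF step(5)]])
       (use rate in \<open>auto intro!: always_eventually\<close>)
  then have "(\<lambda>t. sqrt ((norm (e (Suc t)))\<^sup>2)) \<longlonglongrightarrow> sqrt 0"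
    by (rule tendsto_real_sqrt)
  then have "(\<lambda>t. norm (x (Suc t) - p)) \<longlonglongrightarrow> 0" by (simp add: e_def)
  then have "(\<lambda>t. x (Suc t)) \<longlonglongrightarrow> p"
    by (simp add: LIM_zero_iff tendsto_norm_zero_iff)
  then show ?thesis by (simp add: filterlim_sequentially_Suc)
qed

section \<open>The data term\<close>

text \<open>The Rayleigh bound for a symmetric matrix of size 2, with vectors in place of the two scalar
  coordinates. For \<open>q \<noteq> 0\<close> the smaller root \<open>c\<close> of the characteristic polynomial has the explicit
  eigenvector \<open>(q, c - p)\<close>, and completing the square gives the bound for \<open>c\<close>.\<close>

lemma lowest_eigenvalue_quadratic_form:
  fixes a b :: "'a::real_inner"
  assumes low: "is_lowest_eigenvalue (vector [vector [p, q], vector [q, s]] :: real ^ 2 ^ 2) \<mu>"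
    and q: "q \<noteq> 0"
  shows "\<mu> * ((norm a)\<^sup>2 + (norm b)\<^sup>2) \<le> p * (norm a)\<^sup>2 + 2 * q * (a \<bullet> b) + s * (norm b)\<^sup>2"
proof -
  define D where "D = sqrt ((p - s)\<^sup>2 + 4 * q\<^sup>2)"
  define c where "c = (p + s - D) / 2"
  have D2: "D\<^sup>2 = (p - s)\<^sup>2 + 4 * q\<^sup>2" by (simp add: D_def)
  have "\<bar>p - s\<bar> < D"
    unfolding D_def using q by (intro real_less_rsqrt) auto
  then have A: "p - c > 0" by (simp add: c_def)
  have det: "(p - c) * (s - c) = q\<^sup>2"
    using D2 by (simp add: c_def power2_eq_square field_simps)
  have "is_eigenvalue (vector [vector [p, q], vector [q, s]] :: real ^ 2 ^ 2) c"
    unfolding is_eigenvalue_def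
  proof (intro exI[of _ "vector [q, c - p] :: real ^ 2"] conjI)
    show "vector [q, c - p] \<noteq> (0 :: real ^ 2)"
      using q by (simp add: vec_eq_iff forall_2)
    show "(vector [vector [p, q], vector [q, s]] :: real ^ 2 ^ 2) *v vector [q, c - p]
        = c *\<^sub>R vector [q, c - p]"
      using det
      by (simp add: vec_eq_iff forall_2 matrix_vector_mult_def sum_2 power2_eq_square algebra_simps)
  qed
  then have le: "\<mu> \<le> c" using low by (simp add: is_lowest_eigenvalue_def)
  have "(p - c) * ((p - c) * (norm a)\<^sup>2 + 2 * q * (a \<bullet> b) + (s - c) * (norm b)\<^sup>2)
      = (p - c)\<^sup>2 * (norm a)\<^sup>2 + 2 * ((p - c) * q) * (a \<bullet> b) + ((p - c) * (s - c)) * (norm b)\<^sup>2"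
    by (simp add: power2_eq_square algebra_simps)
  also have "\<dots> = (norm ((p - c) *\<^sub>R a + q *\<^sub>R b))\<^sup>2"
    unfolding det power2_norm_eq_inner
    by (simp add: inner_add_left inner_add_right inner_commute[of b a] power2_eq_square algebra_simps)
  finally have "0 \<le> (p - c) * ((p - c) * (norm a)\<^sup>2 + 2 * q * (a \<bullet> b) + (s - c) * (norm b)\<^sup>2)"
    by simp
  then have "0 \<le> (p - c) * (norm a)\<^sup>2 + 2 * q * (a \<bullet> b) + (s - c) * (norm b)\<^sup>2"
    using A by (simp add: zero_le_mult_iff)
  moreover have "\<mu> * ((norm a)\<^sup>2 + (norm b)\<^sup>2) \<le> c * ((norm a)\<^sup>2 + (norm b)\<^sup>2)"
    using le by (intro mult_right_mono) auto
  ultimately show ?thesis by (simp add: algebra_simps)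
qed

lemma Phi_fst_snd:
  "Phi j1 j2 L x = 1/2 * (\<Sum>j=j1..j2. (norm (fst x + real j *\<^sub>R snd x - log2_image (L j)))\<^sup>2)"
  by (cases x) (simp add: Phi_def)

text \<open>\<^const>\<open>Phi\<close> is a sum of squares of affine maps; the squared norm of their linear part at \<open>(a, b)\<close>
  is the quadratic form of \<^const>\<open>Jmat\<close>, which is bounded below by the lowest eigenvalue.\<close>

lemma strongly_convex_Phi:
  fixes L :: "nat \<Rightarrow> 'n::finite image"
  assumes "j1 < j2" and low: "is_lowest_eigenvalue (Jmat j1 j2) \<mu>"
  shows "strongly_convex \<mu> (Phi j1 j2 L)"
  unfolding strongly_convex_def
proof (intro allI ballI)
  fix x z :: "'n image \<times> 'n image" and s :: real assume s: "s \<in> {0..1}"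
  define T where "T j y = fst y + real j *\<^sub>R snd y - log2_image (L j)" for j and y :: "'n image \<times> 'n image"
  have Phi: "Phi j1 j2 L y = 1/2 * (\<Sum>j=j1..j2. (norm (T j y))\<^sup>2)" for y
    by (simp add: Phi_fst_snd T_def)
  have comb: "T j ((1 - s) *\<^sub>R x + s *\<^sub>R z) = (1 - s) *\<^sub>R T j x + s *\<^sub>R T j z" for j
    by (simp add: T_def algebra_simps)
  define a where "a = fst (x - z)"
  define b where "b = snd (x - z)"
  have diff: "T j x - T j z = a + real j *\<^sub>R b" for j
    by (simp add: T_def a_def b_def algebra_simps)
  have "0 < real j2" using \<open>j1 < j2\<close> by simp
  also have "real j2 \<le> Rmom j1 j2 1"
    unfolding Rmom_def using \<open>j1 < j2\<close> by (simp add: member_le_sum)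
  finally have R1: "Rmom j1 j2 1 \<noteq> 0" by simp
  have "\<mu> * (norm (x - z))\<^sup>2 = \<mu> * ((norm a)\<^sup>2 + (norm b)\<^sup>2)"
    by (simp add: norm_prod_def a_def b_def)
  also have "\<dots> \<le> Rmom j1 j2 0 * (norm a)\<^sup>2 + 2 * Rmom j1 j2 1 * (a \<bullet> b) + Rmom j1 j2 2 * (norm b)\<^sup>2"
    by (rule lowest_eigenvalue_quadratic_form[OF low[unfolded Jmat_def] R1])
  also have "\<dots> = (\<Sum>j=j1..j2. (norm a)\<^sup>2 + 2 * real j * (a \<bullet> b) + (real j)\<^sup>2 * (norm b)\<^sup>2)"
    by (simp add: Rmom_def sum.distrib sum_distrib_left sum_distrib_right)
  also have "\<dots> = (\<Sum>j=j1..j2. (norm (T j x - T j z))\<^sup>2)"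
    unfolding diff power2_norm_eq_inner
    by (intro sum.cong refl)
       (simp add: inner_add_left inner_add_right inner_commute[of b a] power2_eq_square algebra_simps)
  finally have low': "\<mu> * (norm (x - z))\<^sup>2 \<le> (\<Sum>j=j1..j2. (norm (T j x - T j z))\<^sup>2)" .
  have "(\<Sum>j=j1..j2. (norm (T j ((1 - s) *\<^sub>R x + s *\<^sub>R z)))\<^sup>2)
      = (1 - s) * (\<Sum>j=j1..j2. (norm (T j x))\<^sup>2) + s * (\<Sum>j=j1..j2. (norm (T j z))\<^sup>2)
        - s * (1 - s) * (\<Sum>j=j1..j2. (norm (T j x - T j z))\<^sup>2)"
    by (simp only: comb norm_convex_comb_sq sum_subtractf sum.distrib sum_distrib_left)
  then have "Phi j1 j2 L ((1 - s) *\<^sub>R x + s *\<^sub>R z) = (1 - s) * Phi j1 j2 L x + s * Phi j1 j2 L z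
      - 1/2 * (s * (1 - s)) * (\<Sum>j=j1..j2. (norm (T j x - T j z))\<^sup>2)"
    by (simp add: Phi field_simps)
  moreover have "s * (1 - s) * (\<mu> * (norm (x - z))\<^sup>2)
      \<le> s * (1 - s) * (\<Sum>j=j1..j2. (norm (T j x - T j z))\<^sup>2)"
    using low' s by (intro mult_left_mono) auto
  ultimately show "Phi j1 j2 L ((1 - s) *\<^sub>R x + s *\<^sub>R z)
     \<le> (1 - s) * Phi j1 j2 L x + s * Phi j1 j2 L z - \<mu> / 2 * (s * (1 - s)) * (norm (x - z))\<^sup>2"
    by argo
qed

lemma Phi_nonneg: "0 \<le> Phi j1 j2 L x"
  by (simp add: Phi_fst_snd sum_nonneg)

lemma continuous_on_Phi: "continuous_on S (Phi j1 j2 L)"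
  unfolding Phi_fst_snd by (intro continuous_intros)

section \<open>The mixed norm and the difference operator\<close>

text \<open>The vector of the channels of \<open>z\<close> at the grid point \<open>n\<close>.\<close>

definition pixel :: "'n::finite image ^ 'i \<Rightarrow> 'n \<times> 'n \<Rightarrow> real ^ 'i"
  where "pixel z n = (\<chi> i. z $ i $ n)"

lemma norm21_pixel:
  "norm21 z = (\<Sum>n\<in>{..<last_ix} \<times> {..<last_ix}. norm (pixel z n))"
  by (simp add: norm21_def pixel_def norm_vec_def L2_set_def sum.cartesian_product split_def)

lemma inner_pixel: "z \<bullet> w = (\<Sum>n\<in>UNIV. pixel z n \<bullet> pixel w n)"
  unfolding inner_vec_def pixel_def by (subst sum.swap) simp

lemma norm_pixel_le: "norm (pixel z n) \<le> norm z"
proof -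
  have "pixel z n \<bullet> pixel z n \<le> z \<bullet> z"
    unfolding inner_pixel by (rule member_le_sum) auto
  then show ?thesis by (simp add: norm_eq_sqrt_inner)
qed

lemma pixel_scaleR: "pixel (c *\<^sub>R z) n = c *\<^sub>R pixel z n"
  by (simp add: pixel_def vec_eq_iff)

lemma norm21_nonneg: "0 \<le> norm21 z"
  by (simp add: norm21_pixel sum_nonneg)

lemma norm21_scaleR: "0 \<le> c \<Longrightarrow> norm21 (c *\<^sub>R z) = c * norm21 z"
  by (simp add: norm21_pixel pixel_scaleR sum_distrib_left)

lemma continuous_on_norm21: "continuous_on S norm21"
  unfolding norm21_def by (intro continuous_intros)

text \<open>Although \<^const>\<open>norm21\<close> is only a seminorm, its polar set is bounded: testing an element \<open>c\<close> against
  itself gives \<open>\<parallel>c\<parallel>\<^sup>2 \<le> lam * norm21 c\<close>, and the right-hand side is at most a multiple of \<open>\<parallel>c\<parallel>\<close>.\<close>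

lemma bounded_polar_norm21:
  fixes lam :: real
  assumes "0 \<le> lam"
  shows "bounded (polar (\<lambda>z :: 'n::{finite,linorder} image ^ 'i. lam * norm21 z))"
proof -
  define k where "k = real (card ({..<last_ix :: 'n} \<times> {..<last_ix :: 'n}))"
  have "norm c \<le> lam * k" if "c \<in> polar (\<lambda>z. lam * norm21 z)" for c :: "'n image ^ 'i"
  proof -
    have "norm21 c \<le> k * norm c"
      unfolding norm21_pixel k_def by (rule sum_bounded_above) (rule norm_pixel_le)
    then have "lam * norm21 c \<le> lam * (k * norm c)"
      using assms by (rule mult_left_mono)
    moreover have "norm c * norm c \<le> lam * norm21 c"
      using that by (simp add: polar_def norm_eq_sqrt_inner)
    ultimately have "norm c * norm c \<le> lam * k * norm c" by simp
    then show ?thesis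
      using assms by (cases "c = 0") (auto simp: k_def)
  qed
  then show ?thesis by (auto simp: bounded_iff)
qed

lemma norm21_support_function:
  fixes z :: "'n::{finite,linorder} image ^ 'i"
  assumes "0 \<le> lam"
  shows "\<exists>c\<in>polar (\<lambda>z. lam * norm21 z). c \<bullet> z = lam * norm21 z"
proof -
  let ?G = "{..<last_ix :: 'n} \<times> {..<last_ix :: 'n}"
  \<comment> \<open>The normalized channel vector at each summed grid point; \<open>sgn 0 = 0\<close> covers the points
    where \<open>z\<close> vanishes.\<close>
  define c :: "'n image ^ 'i"
    where "c = (\<chi> i n. if n \<in> ?G then lam * sgn (pixel z n) $ i else 0)"
  have pc: "pixel c n = (if n \<in> ?G then lam *\<^sub>R sgn (pixel z n) else 0)" for n
    by (simp add: pixel_def c_def vec_eq_iff)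
  have cw: "c \<bullet> w = lam * (\<Sum>n\<in>?G. sgn (pixel z n) \<bullet> pixel w n)" for w
    unfolding inner_pixel pc sum_distrib_left
    by (intro sum.mono_neutral_cong_right) auto
  have le: "sgn a \<bullet> b \<le> norm b" for a b :: "real ^ 'i"
    using norm_cauchy_schwarz[of "sgn a" b] by (cases "a = 0") (auto simp: norm_sgn)
  have "c \<bullet> w \<le> lam * norm21 w" for w
    unfolding cw norm21_pixel using assms by (intro mult_left_mono sum_mono le)
  then have "c \<in> polar (\<lambda>z. lam * norm21 z)"
    by (simp add: polar_def)
  moreover have "sgn a \<bullet> a = norm a" for a :: "real ^ 'i"
    by (cases "a = 0") (simp_all add: sgn_div_norm dot_square_norm power2_eq_square)
  then have "c \<bullet> z = lam * norm21 z"
    by (simp add: cw norm21_pixel)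
  ultimately show ?thesis by blast
qed

lemma convex_support_function_comp:
  assumes "linear K" and supp: "\<And>z. \<exists>c\<in>polar g. c \<bullet> z = g z"
  shows "strongly_convex 0 (\<lambda>x. g (K x))"
  unfolding strongly_convex_def
proof (intro allI ballI)
  interpret linear K by fact
  fix x z and s :: real assume s: "s \<in> {0..1}"
  obtain c where c: "c \<in> polar g" "c \<bullet> K ((1 - s) *\<^sub>R x + s *\<^sub>R z) = g (K ((1 - s) *\<^sub>R x + s *\<^sub>R z))"
    using supp by blast
  have "g (K ((1 - s) *\<^sub>R x + s *\<^sub>R z)) = (1 - s) * (c \<bullet> K x) + s * (c \<bullet> K z)"
    unfolding c(2)[symmetric] by (simp add: add scale inner_add_right)
  also have "\<dots> \<le> (1 - s) * g (K x) + s * g (K z)"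
    using s c(1) by (intro add_mono mult_left_mono) (auto simp: polar_def)
  finally show "g (K ((1 - s) *\<^sub>R x + s *\<^sub>R z))
      \<le> (1 - s) * g (K x) + s * g (K z) - 0 / 2 * (s * (1 - s)) * (norm (x - z))\<^sup>2"
    by simp
qed

lemma linear_grad: "linear (grad :: 'n::{finite,linorder} image \<Rightarrow> 'n image ^ 2)"
  by (rule linearI) (auto simp: grad_def vec_eq_iff forall_2 algebra_simps)

lemma stack_add: "stack (u + u') (l + l') = stack u l + stack u' l'"
  for u u' l l' :: "'a::monoid_add ^ 2"
  by (simp add: vec_eq_iff forall_4 stack_nth)

lemma stack_scaleR: "stack (c *\<^sub>R u) (c *\<^sub>R l) = c *\<^sub>R stack u l"
  for u l :: "'a::real_vector ^ 2"
  by (simp add: vec_eq_iff forall_4 stack_nth)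

lemma stack_diff: "stack (u - u') (l - l') = stack u l - stack u' l'"
  for u u' l l' :: "'a::group_add ^ 2"
  by (simp add: vec_eq_iff forall_4 stack_nth)

lemma inner_stack: "stack u l \<bullet> stack u' l' = u \<bullet> u' + l \<bullet> l'"
  for u u' l l' :: "'a::real_inner ^ 2"
  by (simp add: inner_vec_def sum_2 sum_4 stack_nth)

text \<open>The linear operator \<open>(v, h) \<mapsto> [D v; \<alpha> D h]\<close>.\<close>

definition coupled_grad ::
    "real \<Rightarrow> 'n::{finite,linorder} image \<times> 'n image \<Rightarrow> 'n image ^ 4"
  where "coupled_grad \<alpha> x = stack (grad (fst x)) (\<alpha> *\<^sub>R grad (snd x))"

lemma linear_coupled_grad: "linear (coupled_grad \<alpha>)"
  by (rule linearI)
     (simp_all add: coupled_grad_def linear_add[OF linear_grad] linear_scale[OF linear_grad]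
        vec_eq_iff forall_4 stack_nth algebra_simps)

lemma coupled_grad_adjoint:
  fixes x :: "'n::{finite,linorder} image \<times> 'n image"
  shows "stack u l \<bullet> coupled_grad \<alpha> x = (adjoint grad u, \<alpha> *\<^sub>R adjoint grad l) \<bullet> x"
proof -
  have "w \<bullet> grad z = adjoint grad w \<bullet> z" for w :: "'n image ^ 2" and z
    using adjoint_works[OF linear_grad, of z w] by (simp only: inner_commute)
  then show ?thesis
    by (simp add: coupled_grad_def inner_stack inner_prod_def)
qed

section \<open>Convergence to a solution of the coupled problem\<close>

theorem theorem4:
  fixes j1 j2 :: nat
    and L :: "nat \<Rightarrow> 'n::{finite,linorder} image"
    and lam \<alpha> \<mu> :: real
    and \<delta> \<nu> \<theta> :: "nat \<Rightarrow> real"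
    and v h :: "nat \<Rightarrow> 'n image"
    and u l ubar lbar :: "nat \<Rightarrow> 'n image ^ 2"
  assumes "CARD('n) \<ge> 2"
    and "0 < j1" "j1 < j2"
    and "\<And>j n. j \<in> {j1..j2} \<Longrightarrow> L j $ n > 0"
    and "lam > 0" "\<alpha> > 0"
    and "\<mu> > 0" "is_lowest_eigenvalue (Jmat j1 j2) \<mu>"
    and "\<delta> 0 > 0" "\<nu> 0 > 0"
    and "\<delta> 0 * \<nu> 0 * max 1 \<alpha> * (onorm (grad :: 'n image \<Rightarrow> 'n image ^ 2))\<^sup>2 < 1"
    and "u 0 = grad (v 0)" "ubar 0 = grad (v 0)"
    and "l 0 = \<alpha> *\<^sub>R grad (h 0)" "lbar 0 = \<alpha> *\<^sub>R grad (h 0)"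
    and "\<And>t. (v (Suc t), h (Suc t)) =
           prox (\<delta> t) (\<lambda>x. ereal (Phi j1 j2 L x))
             ((v t, h t) - \<delta> t *\<^sub>R (adjoint grad (ubar t), \<alpha> *\<^sub>R adjoint grad (lbar t)))"
    and "\<And>t. stack (u (Suc t)) (l (Suc t)) =
           prox (\<nu> t) (fenchel_conj (\<lambda>z. ereal (lam * norm21 z)))
             (stack (u t + \<nu> t *\<^sub>R grad (v (Suc t))) (l t + (\<nu> t * \<alpha>) *\<^sub>R grad (h (Suc t))))"
    and "\<And>t. \<theta> t = (1 + 2 * \<mu> * \<delta> t) powr (- 1/2)"
    and "\<And>t. \<delta> (Suc t) = \<theta> t * \<delta> t"
    and "\<And>t. \<nu> (Suc t) = \<nu> t / \<theta> t"
    and "\<And>t. (ubar (Suc t), lbar (Suc t)) =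
           (u (Suc t), l (Suc t)) + \<theta> t *\<^sub>R ((u (Suc t), l (Suc t)) - (u t, l t))"
  shows "\<exists>x. is_arg_min (coupled_objective j1 j2 L lam \<alpha>) (\<lambda>_. True) x \<and>
             (\<lambda>t. (v t, h t)) \<longlonglongrightarrow> x"
proof -
  note j = assms(3) and lam = assms(5) and \<mu> = assms(7) and low = assms(8)
    and \<delta>0 = assms(9) and \<nu>0 = assms(10) and xstep = assms(16) and ystep = assms(17)
    and \<theta> = assms(18) and \<delta> = assms(19) and \<nu> = assms(20) and extra = assms(21)
  define f :: "'n image \<times> 'n image \<Rightarrow> real" where "f = Phi j1 j2 L"
  define g :: "'n image ^ 4 \<Rightarrow> real" where "g = (\<lambda>z. lam * norm21 z)"
  define K :: "'n image \<times> 'n image \<Rightarrow> 'n image ^ 4" where "K = coupled_grad \<alpha>"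
  define x where "x t = (v t, h t)" for t
  define y where "y t = stack (u t) (l t)" for t
  define ybar where "ybar t = stack (ubar t) (lbar t)" for t
  note step = step_sizes[of \<mu> \<delta> \<theta>, OF \<mu> \<delta>0 \<theta> \<delta>]
  have \<nu>pos: "\<nu> t > 0" for t
    by (induction t) (use \<nu>0 step(2) in \<open>auto simp: \<nu>\<close>)
  have K: "linear K" by (simp add: K_def linear_coupled_grad)
  have supp: "\<exists>c\<in>polar g. c \<bullet> z = g z" for z
    unfolding g_def using lam by (intro norm21_support_function) simp
  have scf: "strongly_convex \<mu> f"
    unfolding f_def by (rule strongly_convex_Phi[OF j low])
  have scF: "strongly_convex \<mu> (\<lambda>x. f x + g (K x))"
    using strongly_convex_add[OF scf convex_support_function_comp[OF K supp]] by simp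
  have gnn: "0 \<le> g z" for z
    using lam by (simp add: g_def norm21_nonneg)
  have fnn: "0 \<le> f z" for z
    by (simp add: f_def Phi_nonneg)
  have fcont: "continuous_on UNIV f"
    by (simp add: f_def continuous_on_Phi)
  have "continuous_on UNIV (\<lambda>x. g (K x))"
    unfolding g_def
    by (intro continuous_intros continuous_on_compose2[OF continuous_on_norm21[of UNIV]]
          linear_continuous_on linear_conv_bounded_linear[THEN iffD1] K) auto
  with fcont have "continuous_on UNIV (\<lambda>x. f x + g (K x))"
    by (intro continuous_intros)
  then obtain p where p: "\<And>z. f p + g (K p) \<le> f z + g (K z)"
    using strongly_convex_attains_min[OF scF \<mu>] fnn gnn by (metis add_nonneg_nonneg)
  have obj: "coupled_objective j1 j2 L lam \<alpha> z = f z + g (K z)" for z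
    by (cases z) (simp add: coupled_objective_def f_def g_def K_def coupled_grad_def)
  have xp: "x (Suc t) = prox (\<delta> t) (\<lambda>x. ereal (f x))
      (x t - \<delta> t *\<^sub>R (adjoint grad (ubar t), \<alpha> *\<^sub>R adjoint grad (lbar t)))" for t
    using xstep[of t] by (simp add: x_def f_def)
  have "y t + \<nu> t *\<^sub>R K (x (Suc t))
      = stack (u t + \<nu> t *\<^sub>R grad (v (Suc t))) (l t + (\<nu> t * \<alpha>) *\<^sub>R grad (h (Suc t)))" for t
    by (simp add: y_def K_def coupled_grad_def x_def stack_add flip: stack_scaleR)
  then have yp: "y (Suc t) = prox (\<nu> t) (fenchel_conj (\<lambda>z. ereal (g z))) (y t + \<nu> t *\<^sub>R K (x (Suc t)))" for t
    using ystep[of t] by (simp add: y_def g_def)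
  have hom: "g (c *\<^sub>R z) = c * g z" if "0 \<le> c" for c z
    using that by (simp add: g_def norm21_scaleR)
  have "x \<longlonglongrightarrow> p"
  proof (rule primal_dual_convergence[of K \<mu> \<delta> \<nu> \<theta> g f p x ybar y,
        OF _ \<mu> \<delta>0 \<nu>0 \<theta> \<delta> \<nu> _ supp])
    show "bounded_linear K" using K by (simp add: linear_conv_bounded_linear)
    show "bounded (polar g)"
      unfolding g_def using lam by (intro bounded_polar_norm21) simp
    show "f p + g (K p) + \<mu> / 2 * (norm (z - p))\<^sup>2 \<le> f z + g (K z)" for z
      by (rule strongly_convex_min_growth[OF scF p])
    show "(1 + \<delta> t * \<mu>) * (norm (x (Suc t) - p))\<^sup>2 + (norm (x (Suc t) - x t))\<^sup>2
       \<le> (norm (x t - p))\<^sup>2 + 2 * \<delta> t * (f p - f (x (Suc t)) + ybar t \<bullet> K (p - x (Suc t)))" for t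
      using prox_three_point[OF scf \<mu> step(1) fnn fcont xp[of t], of p]
      by (simp only: ybar_def K_def coupled_grad_adjoint)
    show "y (Suc t) \<in> polar g" for t
      by (rule prox_conj_sublinear(1)[OF hom gnn \<nu>pos yp])
    show "(y t + \<nu> t *\<^sub>R K (x (Suc t)) - y (Suc t)) \<bullet> (q - y (Suc t)) \<le> 0" if "q \<in> polar g" for t q
      by (rule prox_conj_sublinear(2)[OF hom gnn \<nu>pos yp that])
    show "ybar (Suc t) = y (Suc t) + \<theta> t *\<^sub>R (y (Suc t) - y t)" for t
      using extra[of t] by (simp add: ybar_def y_def stack_add stack_scaleR stack_diff)
  qed
  then have "(\<lambda>t. (v t, h t)) \<longlonglongrightarrow> p" by (simp add: x_def[abs_def])
  moreover have "is_arg_min (coupled_objective j1 j2 L lam \<alpha>) (\<lambda>_. True) p"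
    using p by (simp add: is_arg_min_linorder obj)
  ultimately show ?thesis by blast
qed

end
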